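(* Let $G$ be a fixed finite group. Then the set of satisfiable spherical equations in $G$, i.e. the language $$\mathrm{SphEq}(G)=\Big\{(c_1,\ldots,c_k)\in G^k \;\Big|\; k\in\mathbb{N},\ \exists z_1,\ldots,z_k\in G:\ \prod_{i=1}^k z_i^{-1}c_iz_i=1\Big\}$$ over the finite alphabet $G$, is a regular language with commutative syntactic monoid.
   Context: A spherical equation over a group $G$ is an equation $\prod_{i=1}^k z_i^{-1}c_iz_i=1$ with constants $c_i\in G$ and variables $z_i$; it is satisfiable if there are $z_1,\ldots,z_k\in G$ making it true. The group $G$ is viewed as a finite alphabet, and the tuple $(c_1,\ldots,c_k)$ is identified with the word of length $k$ over the alphabet $G$ whose letters are $c_1,\ldots,c_k$ (each $c_i$ is a single letter). The syntactic monoid of a language $L$ over an alphabet $\Sigma$ is the quotient of $\Sigma^*$ by the congruence $u\sim v \iff \forall x,y\in\Sigma^*: (xuy\in L\Leftrightarrow xvy\in L)$; $L$ is regular if and only if this monoid is finite. *)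

theory Defs
  imports "HOL-Algebra.Group"
begin

text \<open>
  Words over an alphabet \<open>A\<close> are the elements of \<^term>\<open>lists A\<close>.
  Every finite automaton is isomorphic to one whose states are natural numbers, so
  restricting the states to that type loses nothing and avoids quantifying over types.
\<close>

record 'a dfa =
  states :: "nat set"
  init :: nat
  final :: "nat set"
  nxt :: "nat \<Rightarrow> 'a \<Rightarrow> nat"

definition is_dfa :: "'a set \<Rightarrow> 'a dfa \<Rightarrow> bool" where
  "is_dfa A M \<longleftrightarrow> finite (states M) \<and> init M \<in> states M \<and> final M \<subseteq> states M \<and>
     (\<forall>q\<in>states M. \<forall>a\<in>A. nxt M q a \<in> states M)"

definition dfa_language :: "'a set \<Rightarrow> 'a dfa \<Rightarrow> 'a list set" where
  "dfa_language A M = {w \<in> lists A. foldl (nxt M) (init M) w \<in> final M}"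

definition regular_language :: "'a set \<Rightarrow> 'a list set \<Rightarrow> bool" where
  "regular_language A L \<longleftrightarrow> (\<exists>M. is_dfa A M \<and> dfa_language A M = L)"

definition syntactic_congruence :: "'a set \<Rightarrow> 'a list set \<Rightarrow> ('a list \<times> 'a list) set" where
  "syntactic_congruence A L = {(u, v). u \<in> lists A \<and> v \<in> lists A \<and>
     (\<forall>x\<in>lists A. \<forall>y\<in>lists A. x @ u @ y \<in> L \<longleftrightarrow> x @ v @ y \<in> L)}"

text \<open>
  The union below is over classes that all coincide, see \<open>syntactic_monoid_mult\<close>.
\<close>

definition syntactic_monoid :: "'a set \<Rightarrow> 'a list set \<Rightarrow> 'a list set monoid" where
  "syntactic_monoid A L =
     \<lparr>carrier = lists A // syntactic_congruence A L,
      mult = (\<lambda>X Y. \<Union>u\<in>X. \<Union>v\<in>Y. syntactic_congruence A L `` {u @ v}),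
      one = syntactic_congruence A L `` {[]}\<rparr>"

lemma equiv_syntactic_congruence: "equiv (lists A) (syntactic_congruence A L)"
  unfolding syntactic_congruence_def by (rule equivI) (auto simp: refl_on_def sym_def trans_def)

lemma syntactic_congruence_append:
  assumes "(u, u') \<in> syntactic_congruence A L" "(v, v') \<in> syntactic_congruence A L"
  shows "(u @ v, u' @ v') \<in> syntactic_congruence A L"
proof -
  have "x @ (u @ v) @ y \<in> L \<longleftrightarrow> x @ (u' @ v') @ y \<in> L" if "x \<in> lists A" "y \<in> lists A" for x y
  proof -
    have w: "u' \<in> lists A" "v \<in> lists A"
      using assms by (auto simp: syntactic_congruence_def)
    have "x @ u @ (v @ y) \<in> L \<longleftrightarrow> x @ u' @ (v @ y) \<in> L"
      using assms(1) that w by (simp add: syntactic_congruence_def)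
    also have "\<dots> \<longleftrightarrow> (x @ u') @ v @ y \<in> L"
      by simp
    also have "\<dots> \<longleftrightarrow> (x @ u') @ v' @ y \<in> L"
      using assms(2) that w by (simp add: syntactic_congruence_def del: append_assoc)
    finally show ?thesis by simp
  qed
  then show ?thesis using assms by (simp add: syntactic_congruence_def)
qed

lemma syntactic_monoid_mult:
  assumes "u \<in> lists A" "v \<in> lists A"
  shows "syntactic_congruence A L `` {u} \<otimes>\<^bsub>syntactic_monoid A L\<^esub> syntactic_congruence A L `` {v} =
    syntactic_congruence A L `` {u @ v}"
proof -
  let ?R = "syntactic_congruence A L"
  have eq: "?R `` {u' @ v'} = ?R `` {u @ v}" if "u' \<in> ?R `` {u}" "v' \<in> ?R `` {v}" for u' v'
  proof -
    have "(u, u') \<in> ?R" "(v, v') \<in> ?R"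
      using that by simp_all
    then have "(u @ v, u' @ v') \<in> ?R" by (rule syntactic_congruence_append)
    then show ?thesis by (rule equiv_class_eq[OF equiv_syntactic_congruence, symmetric])
  qed
  have ne: "?R `` {w} \<noteq> {}" if "w \<in> lists A" for w
    using equiv_class_self[OF equiv_syntactic_congruence that] by blast
  have "(\<Union>u'\<in>?R `` {u}. \<Union>v'\<in>?R `` {v}. ?R `` {u' @ v'}) = ?R `` {u @ v}"
    by (intro SUP_eq_const ne assms eq)
  then show ?thesis by (simp add: syntactic_monoid_def)
qed

lemma monoid_syntactic_monoid: "monoid (syntactic_monoid A L)"
proof -
  let ?R = "syntactic_congruence A L" and ?S = "syntactic_monoid A L"
  have one: "\<one>\<^bsub>?S\<^esub> = ?R `` {[]}"
    by (simp add: syntactic_monoid_def)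
  have nil: "[] \<in> lists A" by simp
  have app: "u @ v \<in> lists A" if "u \<in> lists A" "v \<in> lists A" for u v
    using that by simp
  have class_in: "?R `` {u} \<in> carrier ?S" if "u \<in> lists A" for u
    using quotientI[OF that] by (simp add: syntactic_monoid_def)
  have class_ex: "\<exists>u. u \<in> lists A \<and> X = ?R `` {u}" if "X \<in> carrier ?S" for X
    using that by (auto simp: syntactic_monoid_def quotient_def)
  show ?thesis
  proof (rule monoidI)
    fix X Y assume "X \<in> carrier ?S" "Y \<in> carrier ?S"
    then obtain u v where u: "u \<in> lists A" "X = ?R `` {u}" and v: "v \<in> lists A" "Y = ?R `` {v}"
      using class_ex by meson
    show "X \<otimes>\<^bsub>?S\<^esub> Y \<in> carrier ?S"
      unfolding u(2) v(2) syntactic_monoid_mult[OF u(1) v(1)] by (rule class_in[OF app[OF u(1) v(1)]])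
  next
    show "\<one>\<^bsub>?S\<^esub> \<in> carrier ?S"
      unfolding one by (rule class_in[OF nil])
  next
    fix X Y Z assume "X \<in> carrier ?S" "Y \<in> carrier ?S" "Z \<in> carrier ?S"
    then obtain u v w where u: "u \<in> lists A" "X = ?R `` {u}" and v: "v \<in> lists A" "Y = ?R `` {v}"
      and w: "w \<in> lists A" "Z = ?R `` {w}"
      using class_ex by meson
    show "X \<otimes>\<^bsub>?S\<^esub> Y \<otimes>\<^bsub>?S\<^esub> Z = X \<otimes>\<^bsub>?S\<^esub> (Y \<otimes>\<^bsub>?S\<^esub> Z)"
      unfolding u(2) v(2) w(2) syntactic_monoid_mult[OF u(1) v(1)] syntactic_monoid_mult[OF v(1) w(1)]
        syntactic_monoid_mult[OF app[OF u(1) v(1)] w(1)]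
        syntactic_monoid_mult[OF u(1) app[OF v(1) w(1)]]
      by (simp only: append_assoc)
  next
    fix X assume "X \<in> carrier ?S"
    then obtain u where u: "u \<in> lists A" "X = ?R `` {u}"
      using class_ex by meson
    show "\<one>\<^bsub>?S\<^esub> \<otimes>\<^bsub>?S\<^esub> X = X"
      unfolding one u(2) syntactic_monoid_mult[OF nil u(1)] by (simp only: append_Nil)
    show "X \<otimes>\<^bsub>?S\<^esub> \<one>\<^bsub>?S\<^esub> = X"
      unfolding one u(2) syntactic_monoid_mult[OF u(1) nil] by (simp only: append_Nil2)
  qed
qed

definition spherical_product :: "('a, 'b) monoid_scheme \<Rightarrow> 'a list \<Rightarrow> 'a list \<Rightarrow> 'a" where
  "spherical_product G zs cs =
     foldr (\<otimes>\<^bsub>G\<^esub>) (map2 (\<lambda>z c. inv\<^bsub>G\<^esub> z \<otimes>\<^bsub>G\<^esub> c \<otimes>\<^bsub>G\<^esub> z) zs cs) \<one>\<^bsub>G\<^esub>"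

definition SphEq :: "('a, 'b) monoid_scheme \<Rightarrow> 'a list set" where
  "SphEq G = {cs \<in> lists (carrier G). \<exists>zs\<in>lists (carrier G).
     length zs = length cs \<and> spherical_product G zs cs = \<one>\<^bsub>G\<^esub>}"

end

theory Submission
  imports Defs
begin

text \<open>
  Prepending a letter \<open>c\<close> to a word turns the set \<open>X\<close> of values of its left-hand side into
  \<open>C X\<close>, where \<open>C\<close> is the conjugacy class of \<open>c\<close>. Since \<open>x y h = y (y\<^sup>-\<^sup>1 x y) h\<close>, the
  operations belonging to different letters commute on subsets of \<open>G\<close>. Hence the set of
  values of a word does not depend on the order of its letters, and the finitely many
  subsets of \<open>G\<close> are the states of an automaton, in which a word is accepted if the set it
  reaches contains \<open>1\<close>.
\<close>

text \<open>Lets automata have states of any type, here sets of group elements: an injection of the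
  finite state set into the naturals renames them to fit \<open>dfa\<close>.\<close>

lemma regular_languageI:
  fixes Q :: "'q set" and \<delta> :: "'q \<Rightarrow> 'a \<Rightarrow> 'q"
  assumes "finite Q" and "q0 \<in> Q" and step: "\<And>q a. q \<in> Q \<Longrightarrow> a \<in> A \<Longrightarrow> \<delta> q a \<in> Q"
    and L: "L = {w \<in> lists A. foldl \<delta> q0 w \<in> F}"
  shows "regular_language A L"
proof -
  obtain e :: "'q \<Rightarrow> nat" where e: "inj_on e Q"
    using finite_imp_inj_to_nat_seg[OF \<open>finite Q\<close>] by blast
  \<comment> \<open>\<open>inv_into Q e\<close> decodes a number back to its state. \<open>F\<close>
    is cut down to \<open>Q\<close> because \<open>e\<close> is injective only there.\<close>
  define M where "M = \<lparr>states = e ` Q, init = e q0, final = e ` (Q \<inter> F),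
    nxt = (\<lambda>n a. e (\<delta> (inv_into Q e n) a))\<rparr>"
  have run: "foldl (nxt M) (e q) w = e (foldl \<delta> q w) \<and> foldl \<delta> q w \<in> Q"
    if "q \<in> Q" "w \<in> lists A" for q w
    using that
  proof (induction w arbitrary: q)
    case (Cons a w)
    then show ?case using Cons.IH[of "\<delta> q a"] step e by (simp add: M_def)
  qed simp
  have "is_dfa A M"
    using assms e by (auto simp: is_dfa_def M_def)
  moreover have "foldl (nxt M) (init M) w \<in> final M \<longleftrightarrow> foldl \<delta> q0 w \<in> F"
    if "w \<in> lists A" for w
    using run[OF \<open>q0 \<in> Q\<close> that] inj_on_image_mem_iff[OF e, of "foldl \<delta> q0 w" "Q \<inter> F"]
    by (simp add: M_def)
  ultimately show ?thesis
    unfolding regular_language_def dfa_language_def L by blast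
qed

text \<open>The assumption says that \<open>u @ v\<close> and \<open>v @ u\<close> are congruent,
  and classes multiply by concatenating representatives.\<close>

lemma comm_monoid_syntactic_monoidI:
  assumes "\<And>x u v y. \<lbrakk>x \<in> lists A; u \<in> lists A; v \<in> lists A; y \<in> lists A\<rbrakk> \<Longrightarrow>
    x @ u @ v @ y \<in> L \<longleftrightarrow> x @ v @ u @ y \<in> L"
  shows "comm_monoid (syntactic_monoid A L)"
proof (rule monoid.monoid_comm_monoidI[OF monoid_syntactic_monoid])
  fix X Y
  assume "X \<in> carrier (syntactic_monoid A L)" "Y \<in> carrier (syntactic_monoid A L)"
  then obtain u v where u: "u \<in> lists A" "X = syntactic_congruence A L `` {u}"
    and v: "v \<in> lists A" "Y = syntactic_congruence A L `` {v}"
    by (auto simp: syntactic_monoid_def elim!: quotientE)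
  have "(u @ v, v @ u) \<in> syntactic_congruence A L"
    using assms u(1) v(1) by (simp add: syntactic_congruence_def)
  then show "X \<otimes>\<^bsub>syntactic_monoid A L\<^esub> Y = Y \<otimes>\<^bsub>syntactic_monoid A L\<^esub> X"
    unfolding u(2) v(2) syntactic_monoid_mult[OF u(1) v(1)] syntactic_monoid_mult[OF v(1) u(1)]
    by (rule equiv_class_eq[OF equiv_syntactic_congruence])
qed

text \<open>The set product of the conjugacy class of \<open>c\<close> with
  \<open>X\<close>.\<close>

definition conj_mult :: "('a, 'b) monoid_scheme \<Rightarrow> 'a \<Rightarrow> 'a set \<Rightarrow> 'a set" where
  "conj_mult G c X = {inv\<^bsub>G\<^esub> z \<otimes>\<^bsub>G\<^esub> c \<otimes>\<^bsub>G\<^esub> z \<otimes>\<^bsub>G\<^esub> h | z h. z \<in> carrier G \<and> h \<in> X}"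

context group
begin

lemma conj_mult_subset:
  assumes "c \<in> carrier G" "X \<subseteq> carrier G"
  shows "conj_mult G c X \<subseteq> carrier G"
  using assms by (auto simp: conj_mult_def)

lemma conj_mult_commute_subset:
  assumes c: "c \<in> carrier G" and d: "d \<in> carrier G" and X: "X \<subseteq> carrier G"
  shows "conj_mult G c (conj_mult G d X) \<subseteq> conj_mult G d (conj_mult G c X)"
proof
  fix g assume "g \<in> conj_mult G c (conj_mult G d X)"
  then obtain z w h where z: "z \<in> carrier G" and w: "w \<in> carrier G" and h: "h \<in> X"
    and g: "g = inv z \<otimes> c \<otimes> z \<otimes> (inv w \<otimes> d \<otimes> w \<otimes> h)"
    by (auto simp: conj_mult_def)
  define y where "y = inv w \<otimes> d \<otimes> w"
  have y: "y \<in> carrier G" and hG: "h \<in> carrier G" using w d h X by (auto simp: y_def)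
  \<comment> \<open>Moving \<open>y\<close> to the front conjugates
    \<open>inv z \<otimes> c \<otimes> z\<close> by \<open>y\<close>, which replaces the conjugator
    \<open>z\<close> of \<open>c\<close> by \<open>z \<otimes> y\<close>.\<close>
  have "g = y \<otimes> (inv (z \<otimes> y) \<otimes> c \<otimes> (z \<otimes> y) \<otimes> h)"
    unfolding g y_def[symmetric] using y z c hG
    by (simp add: inv_mult_group m_assoc inv_solve_left' flip: m_assoc[of y "inv y"])
  moreover have "inv (z \<otimes> y) \<otimes> c \<otimes> (z \<otimes> y) \<otimes> h \<in> conj_mult G c X"
    using z y h unfolding conj_mult_def by blast
  ultimately show "g \<in> conj_mult G d (conj_mult G c X)"
    using w unfolding y_def conj_mult_def[of G d] by blast
qed

lemma conj_mult_commute: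
  assumes "c \<in> carrier G" "d \<in> carrier G" "X \<subseteq> carrier G"
  shows "conj_mult G c (conj_mult G d X) = conj_mult G d (conj_mult G c X)"
  using assms conj_mult_commute_subset by (intro equalityI) auto

lemma foldr_conj_mult_subset:
  assumes "w \<in> lists (carrier G)" "X \<subseteq> carrier G"
  shows "foldr (conj_mult G) w X \<subseteq> carrier G"
  using assms by (induction w) (simp_all add: conj_mult_subset)

text \<open>By commutation, the operation of \<open>c\<close> moves outwards past the letters of
  \<open>w\<close> one at a time.\<close>

lemma foldr_conj_mult_shift:
  assumes "c \<in> carrier G" "w \<in> lists (carrier G)" "X \<subseteq> carrier G"
  shows "foldr (conj_mult G) w (conj_mult G c X) = conj_mult G c (foldr (conj_mult G) w X)"
  using assms(2)
  by (induction w) (use assms in \<open>simp_all add: conj_mult_commute foldr_conj_mult_subset\<close>)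

lemma foldr_conj_mult_append_commute:
  assumes "u \<in> lists (carrier G)" "v \<in> lists (carrier G)" "X \<subseteq> carrier G"
  shows "foldr (conj_mult G) (u @ v) X = foldr (conj_mult G) (v @ u) X"
  using assms(1)
  by (induction u) (use assms in \<open>simp_all add: foldr_conj_mult_shift foldr_conj_mult_subset\<close>)

text \<open>An automaton reads from the left, whereas the set of values is built up from the last
  letter. Commutation makes both orders give the same set.\<close>

lemma foldl_conj_mult:
  assumes "w \<in> lists (carrier G)" "X \<subseteq> carrier G"
  shows "foldl (\<lambda>X c. conj_mult G c X) X w = foldr (conj_mult G) w X"
  using assms
  by (induction w arbitrary: X) (simp_all add: conj_mult_subset foldr_conj_mult_shift)

end

text \<open>The conjugators of different letters are chosen independently, so each letter
  contributes its whole conjugacy class.\<close>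

lemma foldr_conj_mult_one:
  "foldr (conj_mult G) cs {\<one>\<^bsub>G\<^esub>} =
    {spherical_product G zs cs | zs. zs \<in> lists (carrier G) \<and> length zs = length cs}"
proof (induction cs)
  case (Cons c cs)
  have "foldr (conj_mult G) (c # cs) {\<one>\<^bsub>G\<^esub>} = {spherical_product G (z # zs) (c # cs) | z zs.
      z \<in> carrier G \<and> zs \<in> lists (carrier G) \<and> length zs = length cs}"
    by (simp add: Cons.IH conj_mult_def spherical_product_def) blast
  also have "\<dots> = {spherical_product G zs (c # cs) | zs.
      zs \<in> lists (carrier G) \<and> length zs = length (c # cs)}"
    by (fastforce simp: length_Suc_conv)
  finally show ?case .
qed (simp add: spherical_product_def)

lemma SphEq_eq:
  "SphEq G = {cs \<in> lists (carrier G). \<one>\<^bsub>G\<^esub> \<in> foldr (conj_mult G) cs {\<one>\<^bsub>G\<^esub>}}"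
  unfolding SphEq_def foldr_conj_mult_one by (auto intro: sym)

theorem theorem10:
  fixes G :: "('a, 'b) monoid_scheme"
  assumes "group G" and "finite (carrier G)"
  shows "regular_language (carrier G) (SphEq G) \<and>
    comm_monoid (syntactic_monoid (carrier G) (SphEq G))"
proof
  interpret group G by fact
  show "regular_language (carrier G) (SphEq G)"
  proof (rule regular_languageI)
    show "finite (Pow (carrier G))" using assms(2) by simp
    show "{\<one>\<^bsub>G\<^esub>} \<in> Pow (carrier G)" by simp
    show "conj_mult G c X \<in> Pow (carrier G)" if "X \<in> Pow (carrier G)" "c \<in> carrier G" for X c
      using that conj_mult_subset by simp
    show "SphEq G = {w \<in> lists (carrier G).
        foldl (\<lambda>X c. conj_mult G c X) {\<one>\<^bsub>G\<^esub>} w \<in> {X. \<one>\<^bsub>G\<^esub> \<in> X}}"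
      \<comment> \<open>\<open>conj_cong\<close> supplies \<open>w \<in> lists (carrier G)\<close>,
        on which replacing \<open>foldl\<close> by \<open>foldr\<close> depends.\<close>
      unfolding SphEq_eq by (simp add: foldl_conj_mult cong: conj_cong)
  qed
  show "comm_monoid (syntactic_monoid (carrier G) (SphEq G))"
  proof (rule comm_monoid_syntactic_monoidI)
    fix x u v y
    assume "x \<in> lists (carrier G)" "u \<in> lists (carrier G)" "v \<in> lists (carrier G)"
      and y: "y \<in> lists (carrier G)"
    then show "x @ u @ v @ y \<in> SphEq G \<longleftrightarrow> x @ v @ u @ y \<in> SphEq G"
      \<comment> \<open>The suffix \<open>y\<close> is absorbed into the starting set; the prefix
        \<open>x\<close> then acts on equal sets.\<close>
      using foldr_conj_mult_append_commute[of u v "foldr (conj_mult G) y {\<one>\<^bsub>G\<^esub>}"]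
        foldr_conj_mult_subset[OF y]
      by (simp add: SphEq_eq)
  qed
qed

end
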